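(* Say that an integer $a\ge 2$ satisfies the Erdős–Straus property if there exist positive integers $b,c,d$ with $\frac{4}{a}=\frac{1}{b}+\frac{1}{c}+\frac{1}{d}$. Then every integer $a$ of the form $a=2q$ or $a=4q-1$ with $q\ge 1$ an integer satisfies the Erdős–Straus property. Moreover, define for positive integers $x,y,z$ the polynomials \[ p_1(x,y,z)=x(4yz-1)-yz,\quad p_2(x,y,z)=x(4yz-z-1)-yz,\quad p_3(x,y,z)=x(8y-3)-6y+2,\quad p_4(x,y,z)=x^2-x, \] and assume that every positive integer $q\ge 1$ equals $p_i(x,y,z)$ for some $i\in\{1,2,3,4\}$ and some positive integers $x,y,z$. Then every integer of the form $4q+1$ with $q\ge 1$ satisfies the Erdős–Straus property; in particular every prime of this form does.
   Context: The variables $x,y,z$ range over the positive integers. *)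

theory Defs
  imports Complex_Main "HOL-Computational_Algebra.Primes"
begin

definition erdos_straus :: "int \<Rightarrow> bool" where
  "erdos_straus a \<longleftrightarrow> a \<ge> 2 \<and>
     (\<exists>b c d :: int. b > 0 \<and> c > 0 \<and> d > 0 \<and>
        (4 :: rat) / of_int a = 1 / of_int b + 1 / of_int c + 1 / of_int d)"

definition p1 :: "int \<Rightarrow> int \<Rightarrow> int \<Rightarrow> int" where
  "p1 x y z = x * (4 * y * z - 1) - y * z"

definition p2 :: "int \<Rightarrow> int \<Rightarrow> int \<Rightarrow> int" where
  "p2 x y z = x * (4 * y * z - z - 1) - y * z"

definition p3 :: "int \<Rightarrow> int \<Rightarrow> int \<Rightarrow> int" where
  "p3 x y z = x * (8 * y - 3) - 6 * y + 2"

definition p4 :: "int \<Rightarrow> int \<Rightarrow> int \<Rightarrow> int" where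
  "p4 x y z = x ^ 2 - x"

end

theory Submission
  imports Defs
begin

text \<open>
  The property passes from \<open>m\<close> to its positive multiples.  It holds for \<open>2q\<close>, \<open>4q - 1\<close>
  and \<open>8y - 3\<close> by explicit decompositions.  If \<open>q = p\<^sub>i(x,y,z)\<close>, then \<open>4q + 1\<close> is

  \<^item> \<open>(4x - 1)(4yz - 1)\<close> for \<open>i = 1\<close>,
  \<^item> \<open>(4x - 1)N - z\<close> with \<open>N = 4yz - z - 1\<close> for \<open>i = 2\<close>, which has an explicit decomposition,
  \<^item> \<open>(4x - 3)(8y - 3)\<close> for \<open>i = 3\<close>,
  \<^item> \<open>(2x - 1)\<^sup>2\<close> for \<open>i = 4\<close>; here \<open>2x - 1\<close> is either \<open>4k - 1\<close> or \<open>4k + 1\<close> with \<open>1 \<le> k < q\<close>,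
    so that strong induction on \<open>q\<close> applies.
\<close>

lemma erdos_strausI:
  fixes a b c d :: int
  assumes "a \<ge> 2" "b > 0" "c > 0" "d > 0"
    and eq: "4 * (b * c * d) = a * (c * d + b * d + b * c)"
  shows "erdos_straus a"
proof -
  have "of_int (4 * (b * c * d)) = (of_int (a * (c * d + b * d + b * c)) :: rat)"
    by (simp only: eq)
  then have "(4 :: rat) / of_int a = 1 / of_int b + 1 / of_int c + 1 / of_int d"
    using assms(1-4) by (simp add: field_simps)
  with assms(1-4) show ?thesis
    unfolding erdos_straus_def by blast
qed

text \<open>Multiplying all three denominators of a decomposition of \<open>4/m\<close> by
  \<open>k\<close> divides the sum by \<open>k\<close>.\<close>

lemma erdos_straus_mult:
  fixes m k :: int
  assumes "erdos_straus m" "k \<ge> 1"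
  shows "erdos_straus (k * m)"
proof -
  obtain b c d :: int where "m \<ge> 2" and pos: "b > 0" "c > 0" "d > 0"
    and eq: "(4 :: rat) / of_int m = 1 / of_int b + 1 / of_int c + 1 / of_int d"
    using assms(1) unfolding erdos_straus_def by blast
  have "(4 :: rat) / of_int (k * m) = (4 / of_int m) / of_int k"
    by simp
  also have "\<dots> = 1 / of_int (k * b) + 1 / of_int (k * c) + 1 / of_int (k * d)"
    unfolding eq by (simp add: add_divide_distrib mult.commute)
  finally have "(4 :: rat) / of_int (k * m) =
      1 / of_int (k * b) + 1 / of_int (k * c) + 1 / of_int (k * d)" .
  moreover have "k * m \<ge> 2"
    using mult_mono[of 1 k 2 m] \<open>m \<ge> 2\<close> \<open>k \<ge> 1\<close> by simp
  moreover have "k * b > 0" "k * c > 0" "k * d > 0"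
    using pos \<open>k \<ge> 1\<close> by simp_all
  ultimately show ?thesis
    unfolding erdos_straus_def by blast
qed

lemma erdos_straus_even:
  fixes q :: int
  assumes "q \<ge> 1"
  shows "erdos_straus (2 * q)"
  by (rule erdos_strausI[of _ q "2 * q" "2 * q"]) (use assms in \<open>simp_all add: algebra_simps\<close>)

lemma erdos_straus_3_mod_4:
  fixes q :: int
  assumes "q \<ge> 1"
  shows "erdos_straus (4 * q - 1)"
  \<comment> \<open>Subtracting \<open>1/q\<close> from \<open>4/(4q - 1)\<close> leaves
    \<open>1/(q(4q - 1))\<close>, which is split into two equal halves.\<close>
  by (rule erdos_strausI[of _ q "2 * q * (4 * q - 1)" "2 * q * (4 * q - 1)"])
    (use assms in \<open>simp_all add: algebra_simps\<close>)

lemma erdos_straus_5_mod_8: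
  fixes y :: int
  assumes "y \<ge> 1"
  shows "erdos_straus (8 * y - 3)"
  \<comment> \<open>With \<open>a = 8y - 3\<close>, \<open>4/a - 1/(2y) = 3/(2ya)\<close>, and
    \<open>3 = 2 + 1\<close> yields the other two fractions.\<close>
  by (rule erdos_strausI[of _ "2 * y" "y * (8 * y - 3)" "2 * y * (8 * y - 3)"])
    (use assms in \<open>simp_all add: algebra_simps\<close>)

lemma erdos_straus_p1:
  fixes x y z :: int
  assumes "x > 0" "y > 0" "z > 0"
  shows "erdos_straus (4 * p1 x y z + 1)"
proof -
  have "y * z \<ge> 1"
    using mult_pos_pos[OF assms(2,3)] by linarith
  then have "erdos_straus ((4 * x - 1) * (4 * (y * z) - 1))"
    using assms(1) by (intro erdos_straus_mult erdos_straus_3_mod_4) auto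
  then show ?thesis
    by (simp add: p1_def algebra_simps)
qed

text \<open>
  With \<open>a = 4q + 1\<close> and \<open>t = 4xy - x - y\<close> one has \<open>a + (4x - 1) = 4zt\<close> and
  \<open>a + z = (4x - 1)N\<close>, so \<open>4/a - 1/(zt) = (4x - 1)/(azt) = (a + z)/(aztN)\<close>.
\<close>

lemma erdos_straus_p2:
  fixes x y z :: int
  assumes "x > 0" "y > 0" "z > 0"
  shows "erdos_straus (4 * p2 x y z + 1)"
proof -
  define N where "N = 4 * y * z - z - 1"
  define t where "t = 4 * x * y - x - y"
  define a where "a = 4 * p2 x y z + 1"
  have yz: "y * z \<ge> z" and xy: "x * y \<ge> x" "x * y \<ge> y"
    using assms by simp_all
  have N: "N \<ge> 2"
    using yz \<open>z > 0\<close> unfolding N_def mult.assoc by linarith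
  have t: "t > 0"
    using xy assms unfolding t_def mult.assoc by linarith
  have a_t: "a = 4 * (z * t) - (4 * x - 1)" and a_N: "a = (4 * x - 1) * N - z"
    by (simp_all add: a_def N_def t_def p2_def algebra_simps)
  \<comment> \<open>Writing \<open>4x - 1 = 4(x - 1) + 3\<close> gives
    \<open>a \<ge> 3N - z\<close>, where \<open>z\<close> is at most
    \<open>(N + 1)/3\<close>.\<close>
  have "(x - 1) * N \<ge> 0"
    using assms N by simp
  moreover have "N \<ge> 3 * z - 1"
    using yz unfolding N_def mult.assoc by linarith
  moreover have "a = 4 * ((x - 1) * N) + 3 * N - z"
    by (simp add: a_N algebra_simps)
  ultimately have a: "a \<ge> 2"
    using N \<open>z > 0\<close> by linarith
  have "4 * (z * t) * N = a * N + (a + z)"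
  proof -
    have "4 * (z * t) = a + (4 * x - 1)" "a + z = (4 * x - 1) * N"
      using a_t a_N by simp_all
    then show ?thesis
      by (simp only: distrib_right)
  qed
  \<comment> \<open>The remainder splits as \<open>(a + z)/(aztN) = 1/(ztN) + 1/(atN)\<close>; the
    extra factor produces the cleared form required by \<open>erdos_strausI\<close>.\<close>
  then have "(z * t) * (a * t) * N * (4 * (z * t) * N) =
      (z * t) * (a * t) * N * (a * N + (a + z))"
    by (rule arg_cong)
  then have "4 * ((z * t) * (z * t * N) * (a * t * N)) =
      a * ((z * t * N) * (a * t * N) + (z * t) * (a * t * N) + (z * t) * (z * t * N))"
    by (simp only: algebra_simps)
  then have "erdos_straus a"
    using a N t \<open>z > 0\<close>
    by (intro erdos_strausI[of a "z * t" "z * t * N" "a * t * N"]) auto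
  then show ?thesis
    by (simp add: a_def)
qed

lemma erdos_straus_p3:
  fixes x y z :: int
  assumes "x > 0" "y > 0"
  shows "erdos_straus (4 * p3 x y z + 1)"
proof -
  have "erdos_straus ((4 * x - 3) * (8 * y - 3))"
    using assms by (intro erdos_straus_mult erdos_straus_5_mod_8) auto
  then show ?thesis
    by (simp add: p3_def algebra_simps)
qed

lemma erdos_straus_p4:
  fixes x y z :: int
  assumes "x \<ge> 2"
    and smaller: "\<And>k. 1 \<le> k \<Longrightarrow> k < p4 x y z \<Longrightarrow> erdos_straus (4 * k + 1)"
  shows "erdos_straus (4 * p4 x y z + 1)"
proof -
  have "erdos_straus (2 * x - 1)"
  proof (cases "even x")
    case True
    then obtain k where "x = 2 * k" ..
    with \<open>x \<ge> 2\<close> show ?thesis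
      using erdos_straus_3_mod_4[of k] by simp
  next
    case False
    \<comment> \<open>Now \<open>2x - 1 = 4k + 1\<close>, and
      \<open>k < 4k^2 + 2k = p4 x y z\<close> makes \<open>smaller\<close> applicable.\<close>
    then obtain k where k: "x = 2 * k + 1" ..
    with \<open>x \<ge> 2\<close> have "k \<ge> 1" by simp
    then have "k * k > 0" by simp
    moreover have p4_eq: "p4 x y z = 4 * (k * k) + 2 * k"
      by (simp add: p4_def k power2_eq_square algebra_simps)
    ultimately have "k < p4 x y z"
      using \<open>k \<ge> 1\<close> unfolding p4_eq by linarith
    then show ?thesis
      using smaller[of k] \<open>k \<ge> 1\<close> k by (simp add: add.commute)
  qed
  then have "erdos_straus ((2 * x - 1) * (2 * x - 1))"
    using \<open>x \<ge> 2\<close> by (intro erdos_straus_mult) auto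
  then show ?thesis
    by (simp add: p4_def power2_eq_square algebra_simps)
qed

lemma erdos_straus_1_mod_4:
  fixes q :: int
  assumes cover: "\<And>q :: int. q \<ge> 1 \<Longrightarrow>
      \<exists>p \<in> {p1, p2, p3, p4}. \<exists>x y z :: int. x > 0 \<and> y > 0 \<and> z > 0 \<and> q = p x y z"
    and "q \<ge> 1"
  shows "erdos_straus (4 * q + 1)"
  using \<open>q \<ge> 1\<close>
proof (induction "nat q" arbitrary: q rule: less_induct)
  case less
  obtain p and x y z :: int where p: "p \<in> {p1, p2, p3, p4}"
    and pos: "x > 0" "y > 0" "z > 0" and q: "q = p x y z"
    using cover[OF less.prems] by blast
  from p consider "p = p1" | "p = p2" | "p = p3" | "p = p4" by blast
  then show ?case
  proof cases
    case 1
    then show ?thesis using q pos erdos_straus_p1 by simp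
  next
    case 2
    then show ?thesis using q pos erdos_straus_p2 by simp
  next
    case 3
    then show ?thesis using q pos erdos_straus_p3 by simp
  next
    case 4
    then have q4: "q = p4 x y z" using q by simp
    \<comment> \<open>The value \<open>x = 1\<close> would give \<open>q = 0\<close>.\<close>
    then have "x \<noteq> 1"
      using less.prems by (auto simp: p4_def)
    then have "x \<ge> 2" using pos by simp
    then show ?thesis
      unfolding q4 by (rule erdos_straus_p4) (use less q4 in auto)
  qed
qed

theorem theorem4:
  "(\<forall>a q :: int. q \<ge> 1 \<and> (a = 2 * q \<or> a = 4 * q - 1) \<longrightarrow> erdos_straus a) \<and>
   ((\<forall>q :: int. q \<ge> 1 \<longrightarrow>
       (\<exists>p \<in> {p1, p2, p3, p4}. \<exists>x y z :: int. x > 0 \<and> y > 0 \<and> z > 0 \<and> q = p x y z)) \<longrightarrow>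
     (\<forall>a q :: int. q \<ge> 1 \<and> a = 4 * q + 1 \<longrightarrow> erdos_straus a) \<and>
     (\<forall>a q :: int. q \<ge> 1 \<and> a = 4 * q + 1 \<and> prime a \<longrightarrow> erdos_straus a))"
  using erdos_straus_even erdos_straus_3_mod_4 erdos_straus_1_mod_4 by blast

end
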